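(* $F_e(J_4,J_4;5)\le 51$; that is, there exists a $K_5$-free graph $G$ on 51 vertices such that every red-blue coloring of $E(G)$ contains a monochromatic copy of $J_4$.
   Context: All graphs are finite and simple. $J_4$ denotes $K_4$ with one edge removed. $G\rightarrow(H_1,H_2)^e$ means: for every coloring of $E(G)$ with colors 1, 2 there is $i$ such that the subgraph formed by the edges of color $i$ contains a (not necessarily induced) copy of $H_i$. The edge Folkman number $F_e(H_1,H_2;k)$ is the minimum number of vertices of a $K_k$-free graph $G$ with $G\rightarrow(H_1,H_2)^e$. *)

theory Defs
  imports Main
begin

definition simple_graph :: "'a set \<Rightarrow> 'a set set \<Rightarrow> bool" where
  "simple_graph V E \<longleftrightarrow> finite V \<and> (\<forall>e\<in>E. e \<subseteq> V \<and> card e = 2)"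

definition has_copy :: "'b set \<Rightarrow> 'b set set \<Rightarrow> 'a set \<Rightarrow> 'a set set \<Rightarrow> bool" where
  "has_copy VH EH V E \<longleftrightarrow>
     (\<exists>f. inj_on f VH \<and> f ` VH \<subseteq> V \<and> (\<forall>e\<in>EH. f ` e \<in> E))"

definition clique_free :: "nat \<Rightarrow> 'a set \<Rightarrow> 'a set set \<Rightarrow> bool" where
  "clique_free k V E \<longleftrightarrow>
     \<not> (\<exists>S\<subseteq>V. card S = k \<and> (\<forall>u\<in>S. \<forall>v\<in>S. u \<noteq> v \<longrightarrow> {u, v} \<in> E))"

definition J4_V :: "nat set" where
  "J4_V = {0..<4}"

definition J4_E :: "nat set set" where
  "J4_E = {e. \<exists>u v. e = {u, v} \<and> u < 4 \<and> v < 4 \<and> u \<noteq> v} - {{2, 3}}"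

definition edge_arrows ::
  "'a set \<Rightarrow> 'a set set \<Rightarrow> 'b set \<Rightarrow> 'b set set \<Rightarrow> 'c set \<Rightarrow> 'c set set \<Rightarrow> bool" where
  "edge_arrows V E VH1 EH1 VH2 EH2 \<longleftrightarrow>
     (\<forall>c :: 'a set \<Rightarrow> bool.
        has_copy VH1 EH1 V {e\<in>E. c e} \<or> has_copy VH2 EH2 V {e\<in>E. \<not> c e})"

end

theory Submission
  imports Defs
begin

text \<open>
  Join a new vertex, the apex, to a blow-up of a \<open>K\<^sub>4\<close>-free graph on 14 vertices in which every
  2-colouring of the vertices has a monochromatic triangle through one of four distinguished
  vertices. Those four are replaced by independent sets of size 5, all others by independent sets
  of size 3, which gives \<open>1 + 4 * 5 + 10 * 3 = 51\<close> vertices. Colour each non-apex vertex by the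
  colour of its edge to the apex; the majority colours of the blobs then colour the 14-vertex
  graph, so some \<open>K\<^sub>2\<^sub>,\<^sub>2\<^sub>,\<^sub>3\<close> is coloured by a single colour \<open>k\<close>. If there is no monochromatic
  \<open>J\<^sub>4\<close>, its edges of colour \<open>k\<close> form a matching, for two adjacent ones would make a \<open>J\<^sub>4\<close> with the
  apex, and the absence of a \<open>J\<^sub>4\<close> in the other colour forces this matching to be perfect on each
  octahedron \<open>K\<^sub>2\<^sub>,\<^sub>2\<^sub>,\<^sub>2\<close>. But a vertex \<open>z\<close> of the part of size 3 would then be matched to a vertex
  that also has a partner inside the octahedron avoiding \<open>z\<close>.
\<close>

section \<open>The core graph and its vertex colourings\<close>

definition core_edges :: "(nat \<times> nat) list" where
  "core_edges =
  [(0,1), (0,3), (0,11), (0,12), (1,4), (1,7), (1,9), (1,10), (1,11), (1,12),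
   (2,4), (2,5), (2,10), (2,12), (3,4), (3,5), (3,8), (3,11), (3,12), (3,13),
   (4,6), (4,10), (4,12), (4,13), (5,7), (5,9), (5,10), (5,11), (5,12), (6,7),
   (6,12), (6,13), (7,8), (7,10), (7,12), (7,13), (8,12), (8,13), (9,11),
   (9,12), (10,11), (10,13), (11,13)]"

definition core_adj :: "nat \<Rightarrow> nat \<Rightarrow> bool" where
  "core_adj i j \<longleftrightarrow> (i, j) \<in> set core_edges \<or> (j, i) \<in> set core_edges"

text \<open>The graph was found by a computer search. The third entry of each listed triangle is one of
  the distinguished vertices 10, 11, 12, 13; not all triangles are needed.\<close>

definition core_triangles :: "(nat \<times> nat \<times> nat) list" where
  "core_triangles =
  [(0,1,11), (0,1,12), (0,3,11), (0,3,12), (1,4,10), (1,4,12), (1,7,10),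
   (1,7,12), (1,9,11), (1,9,12), (2,4,10), (2,4,12), (2,5,10), (2,5,12),
   (3,4,12), (3,4,13), (3,5,11), (3,5,12), (3,8,12), (3,8,13), (4,6,12),
   (4,6,13), (5,7,10), (5,7,12), (5,9,11), (5,9,12), (6,7,12), (6,7,13),
   (7,8,12), (7,8,13), (10,11,13)]"

lemma core_adj_sym: "core_adj i j \<Longrightarrow> core_adj j i"
  by (auto simp: core_adj_def)

lemma core_adj_irrefl: "\<not> core_adj i i"
  by (auto simp: core_adj_def core_edges_def)

text \<open>A K4 consists of two disjoint edges and all four cross pairs. The cross condition is
  invariant under reversing either edge, so testing pairs of listed edges suffices.\<close>

lemma core_K4_free:
  assumes "core_adj a b" "core_adj c d" "core_adj a c" "core_adj a d" "core_adj b c" "core_adj b d"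
  shows False
proof -
  have "\<forall>(a, b)\<in>set core_edges. \<forall>(c, d)\<in>set core_edges.
      \<not> (core_adj a c \<and> core_adj a d \<and> core_adj b c \<and> core_adj b d)"
    by code_simp
  with assms show False
    unfolding core_adj_def by blast
qed

lemma core_triangles_adj:
  assumes "(i, j, l) \<in> set core_triangles"
  shows "core_adj i j" "core_adj i l" "core_adj j l" "i < 14" "j < 14" "l \<in> {10, 11, 12, 13}"
proof -
  have "\<forall>(i, j, l)\<in>set core_triangles. core_adj i j \<and> core_adj i l \<and> core_adj j l \<and>
      i < 14 \<and> j < 14 \<and> l \<in> {10, 11, 12, 13}"
    by code_simp
  with assms
  show "core_adj i j" "core_adj i l" "core_adj j l" "i < 14" "j < 14" "l \<in> {10, 11, 12, 13}"
    by auto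
qed

lemma core_monochromatic_triangle:
  fixes f :: "nat \<Rightarrow> bool"
  shows "\<exists>(i, j, l)\<in>set core_triangles. f i = f j \<and> f j = f l"
proof (rule ccontr)
  assume "\<not> ?thesis"
  then have "\<forall>(i, j, l)\<in>set core_triangles. \<not> (f i = f j \<and> f j = f l)"
    by auto
  then show False
    \<comment> \<open>This leaves an unsatisfiable propositional problem in the 14 atoms
      \<open>f 0\<close>, ..., \<open>f 13\<close>.\<close>
    unfolding core_triangles_def list.set ball_simps prod.case
    by sat
qed

section \<open>Colourings of a complete tripartite graph and an apex\<close>

definition adjacent_all :: "('a \<Rightarrow> 'a \<Rightarrow> bool) \<Rightarrow> 'a set \<Rightarrow> 'a set \<Rightarrow> bool" where
  "adjacent_all adj X Y \<longleftrightarrow> (\<forall>x\<in>X. \<forall>y\<in>Y. adj x y \<and> adj y x)"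

text \<open>The variable \<open>k\<close> covers both colours. The pair \<open>r\<close>,
  \<open>s\<close> is the missing edge of J4; its adjacency is left open because copies need not be
  induced.\<close>

locale J4_free_colouring =
  fixes adj :: "'a \<Rightarrow> 'a \<Rightarrow> bool" and col :: "'a \<Rightarrow> 'a \<Rightarrow> bool"
  assumes adj_irrefl: "\<not> adj x x"
    and col_sym: "col x y = col y x"
    and no_mono_J4: "\<lbrakk>adj p q; adj p r; adj p s; adj q r; adj q s; r \<noteq> s; col p q = k;
      col p r = k; col p s = k; col q r = k; col q s = k\<rbrakk> \<Longrightarrow> False"
begin

lemma apex_matching:
  assumes "adjacent_all adj {w} {x, y, z}" "adj x y" "adj x z" "y \<noteq> z"
    and "col w x = k" "col w y = k" "col w z = k" "col x y = k"
  shows "col x z = (\<not> k)"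
  using no_mono_J4[of w x y z k] assms unfolding adjacent_all_def by blast

text \<open>If \<open>a\<close> is unmatched, the copies of J4 on \<open>a\<close>, one vertex of a
  pair and the whole other pair (\<open>b\<close>, \<open>b'\<close> or \<open>c\<close>,
  \<open>c'\<close>) make the \<open>k\<close>-edges a perfect matching of the 4-cycle
  \<open>b c b' c'\<close>. Take an edge of this cycle outside the matching: its ends are already
  matched, so they have no \<open>k\<close>-edge to \<open>a'\<close>, and with \<open>a\<close>,
  \<open>a'\<close> they span a J4 in the other colour.\<close>

lemma octahedron_matched:
  assumes w: "adjacent_all adj {w} {a, a', b, b', c, c'}"
    and adj: "adjacent_all adj {a, a'} {b, b'}" "adjacent_all adj {a, a'} {c, c'}"
      "adjacent_all adj {b, b'} {c, c'}"
    and ne: "a \<noteq> a'" "b \<noteq> b'" "c \<noteq> c'"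
    and k: "\<forall>x\<in>{a, a', b, b', c, c'}. col w x = k"
  shows "\<exists>y\<in>{b, b', c, c'}. col a y = k"
proof (rule ccontr)
  assume "\<not> ?thesis"
  then have a: "col a b \<noteq> k" "col a b' \<noteq> k" "col a c \<noteq> k" "col a c' \<noteq> k"
    by auto
  note adjs = adj[unfolded adjacent_all_def, simplified]
  have M: "\<not> (col x y = k \<and> col x z = k)"
    if "adj x y" "adj x z" "y \<noteq> z" "{x, y, z} \<subseteq> {a, a', b, b', c, c'}" for x y z
    using apex_matching[of w x y z k] that w k unfolding adjacent_all_def by blast
  have J: "col p q = k \<or> col p r = k \<or> col p s = k \<or> col q r = k \<or> col q s = k"
    if "adj p q" "adj p r" "adj p s" "adj q r" "adj q s" "r \<noteq> s" for p q r s
    using no_mono_J4[of p q r s "\<not> k"] that by blast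
  \<comment> \<open>One orientation per edge, so that the final \<open>sat\<close> sees a single
    atom for it.\<close>
  note flip = col_sym[of b a] col_sym[of b' a] col_sym[of c a] col_sym[of c' a]
    col_sym[of b a'] col_sym[of b' a'] col_sym[of c a'] col_sym[of c' a']
    col_sym[of c b] col_sym[of c b'] col_sym[of c' b] col_sym[of c' b']
  have "\<not> (col b c = k \<and> col b c' = k)" "\<not> (col b' c = k \<and> col b' c' = k)"
    "\<not> (col b c = k \<and> col b' c = k)" "\<not> (col b c' = k \<and> col b' c' = k)"
    using M[of b c c'] M[of b' c c'] M[of c b b'] M[of c' b b'] adjs ne by (simp_all add: flip)
  moreover have "a' \<noteq> b" "a' \<noteq> b'" "a' \<noteq> c" "a' \<noteq> c'"
    using adjs adj_irrefl by blast+
  then have "\<not> (col a' b = k \<and> col b c = k)" "\<not> (col a' b = k \<and> col b c' = k)"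
    "\<not> (col a' b' = k \<and> col b' c = k)" "\<not> (col a' b' = k \<and> col b' c' = k)"
    "\<not> (col a' c = k \<and> col b c = k)" "\<not> (col a' c = k \<and> col b' c = k)"
    "\<not> (col a' c' = k \<and> col b c' = k)" "\<not> (col a' c' = k \<and> col b' c' = k)"
    using M[of b a' c] M[of b a' c'] M[of b' a' c] M[of b' a' c']
      M[of c a' b] M[of c a' b'] M[of c' a' b] M[of c' a' b'] adjs ne by (simp_all add: flip)
  moreover have "col b c = k \<or> col a' b = k \<or> col a' c = k"
    "col b c' = k \<or> col a' b = k \<or> col a' c' = k"
    "col b' c = k \<or> col a' b' = k \<or> col a' c = k"
    "col b' c' = k \<or> col a' b' = k \<or> col a' c' = k"
    using J[of b c a a'] J[of b c' a a'] J[of b' c a a'] J[of b' c' a a'] a adjs ne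
    by (simp_all add: flip)
  moreover have "col b c = k \<or> col b' c = k" "col b c' = k \<or> col b' c' = k"
    "col b c = k \<or> col b c' = k" "col b' c = k \<or> col b' c' = k"
    using J[of a c b b'] J[of a c' b b'] J[of a b c c'] J[of a b' c c'] a adjs ne
    by (simp_all add: flip)
  ultimately show False
    by sat
qed

text \<open>Without \<open>z\<close> an octahedron remains, and it already contains a partner of
  \<open>x\<close>; \<open>z\<close> would be a second one.\<close>

lemma K223_no_matched_spoke:
  assumes w: "adjacent_all adj {w} {x, x', y, y', z, z', z''}"
    and adj: "adjacent_all adj {x, x'} {y, y'}" "adjacent_all adj {x, x'} {z, z', z''}"
      "adjacent_all adj {y, y'} {z, z', z''}"
    and ne: "x \<noteq> x'" "y \<noteq> y'" "distinct [z, z', z'']"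
    and k: "\<forall>v\<in>{x, x', y, y', z, z', z''}. col w v = k"
  shows "col x z \<noteq> k"
proof
  assume xz: "col x z = k"
  have "\<exists>v\<in>{y, y', z', z''}. col x v = k"
    by (rule octahedron_matched[of w x x' y y' z' z'' k])
      (use w adj ne k in \<open>simp_all add: adjacent_all_def\<close>)
  then obtain v where v: "v \<in> {y, y', z', z''}" "col x v = k"
    by blast
  have "adjacent_all adj {w} {x, z, v}" "adj x z" "adj x v"
    using v(1) w adj unfolding adjacent_all_def by blast+
  moreover have "z \<noteq> v"
    using v(1) ne adj adj_irrefl unfolding adjacent_all_def by auto
  moreover have "col w x = k" "col w z = k" "col w v = k"
    using v(1) k by blast+
  ultimately show False
    using apex_matching[of w x z v k] xz v(2) by blast
qed

lemma no_monochromatic_K223: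
  assumes w: "adjacent_all adj {w} {x, x', y, y', z, z', z''}"
    and adj: "adjacent_all adj {x, x'} {y, y'}" "adjacent_all adj {x, x'} {z, z', z''}"
      "adjacent_all adj {y, y'} {z, z', z''}"
    and ne: "x \<noteq> x'" "y \<noteq> y'" "distinct [z, z', z'']"
    and k: "\<forall>v\<in>{x, x', y, y', z, z', z''}. col w v = k"
  shows False
proof -
  \<comment> \<open>Here the octahedron omits \<open>z''\<close>. By symmetry the previous lemma
    excludes all four possible partners of \<open>z\<close>.\<close>
  have "\<exists>u\<in>{x, x', y, y'}. col z u = k"
    by (rule octahedron_matched[of w z z' x x' y y' k])
      (use w adj ne k in \<open>simp_all add: adjacent_all_def\<close>)
  then have "col x z = k \<or> col x' z = k \<or> col y z = k \<or> col y' z = k"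
    using col_sym[of z] by auto
  moreover have "col x z \<noteq> k"
    by (rule K223_no_matched_spoke[of w x x' y y' z z' z'' k])
      (use w adj ne k in \<open>simp_all add: adjacent_all_def\<close>)
  moreover have "col x' z \<noteq> k"
    by (rule K223_no_matched_spoke[of w x' x y y' z z' z'' k])
      (use w adj ne k in \<open>simp_all add: adjacent_all_def\<close>)
  moreover have "col y z \<noteq> k"
    by (rule K223_no_matched_spoke[of w y y' x x' z z' z'' k])
      (use w adj ne k in \<open>simp_all add: adjacent_all_def\<close>)
  moreover have "col y' z \<noteq> k"
    by (rule K223_no_matched_spoke[of w y' y x x' z z' z'' k])
      (use w adj ne k in \<open>simp_all add: adjacent_all_def\<close>)
  ultimately show False
    by blast
qed

end

section \<open>The 51-vertex graph\<close>

text \<open>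
  The apex is 50. The vertices \<open>42, \<dots>, 49\<close> go in pairs to the distinguished blobs 10, 11, 12, 13.
\<close>

definition blob :: "nat \<Rightarrow> nat" where
  "blob x = (if x < 42 then x mod 14 else 10 + x mod 4)"

definition G_adj :: "nat \<Rightarrow> nat \<Rightarrow> bool" where
  "G_adj x y \<longleftrightarrow> x = 50 \<and> y < 50 \<or> y = 50 \<and> x < 50 \<or> x < 50 \<and> y < 50 \<and> core_adj (blob x) (blob y)"

definition G_E :: "nat set set" where
  "G_E = {{x, y} | x y. G_adj x y}"

lemma G_adj_sym: "G_adj x y \<longleftrightarrow> G_adj y x"
  unfolding G_adj_def using core_adj_sym by blast

lemma G_adj_irrefl: "\<not> G_adj x x"
  by (auto simp: G_adj_def core_adj_irrefl)

lemma G_E_iff: "{x, y} \<in> G_E \<longleftrightarrow> G_adj x y"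
  unfolding G_E_def using G_adj_sym by (auto simp: doubleton_eq_iff)

lemma G_adj_less: "G_adj x y \<Longrightarrow> x < 51 \<and> y < 51"
  by (auto simp: G_adj_def)

lemma simple_graph_G: "simple_graph {..<51} G_E"
  unfolding simple_graph_def G_E_def
  using G_adj_less G_adj_irrefl by (fastforce simp: card_2_iff)

lemma card_4_obtain:
  assumes "card S = 4"
  obtains a b c d where "S = {a, b, c, d}" "distinct [a, b, c, d]"
  using assms by (auto simp: card_Suc_eq numeral_eq_Suc)

text \<open>At most one vertex of a 5-clique is the apex; the other four project along
  \<open>blob\<close> to a K4 of the core.\<close>

lemma clique_free_G: "clique_free 5 {..<51} G_E"
  unfolding clique_free_def
proof (intro notI, elim exE conjE)
  fix S :: "nat set"
  assume S: "card S = 5" "\<forall>u\<in>S. \<forall>v\<in>S. u \<noteq> v \<longrightarrow> {u, v} \<in> G_E"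
  have "4 \<le> card (S - {50})"
    using S(1) by (simp add: card_Diff_singleton_if)
  then obtain T where T: "T \<subseteq> S - {50}" "card T = 4"
    using obtain_subset_with_card_n by metis
  then obtain a b c d where abcd: "T = {a, b, c, d}" "distinct [a, b, c, d]"
    using card_4_obtain by blast
  have "core_adj (blob u) (blob v)" if "u \<in> T" "v \<in> T" "u \<noteq> v" for u v
  proof -
    have "G_adj u v"
      using S(2) T(1) that by (auto simp flip: G_E_iff)
    then show ?thesis
      using T(1) that by (auto simp: G_adj_def)
  qed
  then show False
    using core_K4_free[of "blob a" "blob b" "blob c" "blob d"] abcd by auto
qed

lemma less_4_iff: "(i :: nat) < 4 \<longleftrightarrow> i = 0 \<or> i = 1 \<or> i = 2 \<or> i = 3"
  by auto

lemma J4_V_eq: "J4_V = {0, 1, 2, 3}"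
  by (auto simp: J4_V_def)

lemma J4_E_subset: "J4_E \<subseteq> {{0, 1}, {0, 2}, {0, 3}, {1, 2}, {1, 3}}"
  by (auto simp: J4_E_def less_4_iff insert_commute)

lemma has_copy_J4I:
  assumes "{p, q, r, s} \<subseteq> V" "distinct [p, q, r, s]"
    and E: "{p, q} \<in> E" "{p, r} \<in> E" "{p, s} \<in> E" "{q, r} \<in> E" "{q, s} \<in> E"
  shows "has_copy J4_V J4_E V E"
proof -
  let ?f = "\<lambda>i. [p, q, r, s] ! i"
  have "inj_on ?f J4_V" "?f ` J4_V \<subseteq> V"
    using assms(1,2) by (auto simp: J4_V_eq)
  moreover have "\<forall>e\<in>{{0, 1}, {0, 2}, {0, 3}, {1, 2}, {1, 3}}. ?f ` e \<in> E"
    using E by simp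
  ultimately show ?thesis
    unfolding has_copy_def using J4_E_subset by blast
qed

text \<open>The \<open>Suc\<close> rounds half the size up: 3 vertices yield 2 of one colour, and 5
  yield 3.\<close>

lemma pigeonhole_two_colours:
  fixes f :: "'a \<Rightarrow> bool"
  assumes "2 * m \<le> Suc (card A)"
  shows "\<exists>k. m \<le> card {v \<in> A. f v = k}"
proof -
  have "A = {v \<in> A. f v = True} \<union> {v \<in> A. f v = False}"
    by auto
  then have "card A \<le> card {v \<in> A. f v = True} + card {v \<in> A. f v = False}"
    using card_Un_le by metis
  then have "m \<le> card {v \<in> A. f v = True} \<or> m \<le> card {v \<in> A. f v = False}"
    using assms by linarith
  then show ?thesis
    by blast
qed

lemma card_blob_ge_3:
  assumes "i < 14"
  shows "3 \<le> card {v. v < 50 \<and> blob v = i}"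
proof -
  have "(i + 28) mod 14 = i"
    using assms by presburger
  then have "{i, i + 14, i + 28} \<subseteq> {v. v < 50 \<and> blob v = i}"
    using assms by (auto simp: blob_def)
  from card_mono[OF _ this] show ?thesis
    by simp
qed

lemma card_blob_ge_5:
  assumes "i \<in> {10, 11, 12, 13}"
  shows "5 \<le> card {v. v < 50 \<and> blob v = i}"
proof -
  \<comment> \<open>Since 42 is 2 modulo 4, \<open>m\<close> is the first number from 42 on that is
    congruent to \<open>i - 10\<close>; thus \<open>m\<close> and \<open>m + 4\<close> are the two
    extra vertices of blob \<open>i\<close>.\<close>
  define m where "m = 42 + (i - 8) mod 4"
  have "{i, i + 14, i + 28, m, m + 4} \<subseteq> {v. v < 50 \<and> blob v = i}"
    using assms by (auto simp: blob_def m_def)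
  from card_mono[OF _ this] show ?thesis
    using assms by (auto simp: m_def)
qed

lemma J4_arrows_G: "edge_arrows {..<51} G_E J4_V J4_E J4_V J4_E"
  unfolding edge_arrows_def
proof (rule allI, rule ccontr)
  fix c :: "nat set \<Rightarrow> bool"
  assume nocopy: "\<not> (has_copy J4_V J4_E {..<51} {e \<in> G_E. c e} \<or>
      has_copy J4_V J4_E {..<51} {e \<in> G_E. \<not> c e})"
  interpret J4_free_colouring G_adj "\<lambda>x y. c {x, y}"
  proof
    show "\<not> G_adj x x" for x
      by (rule G_adj_irrefl)
    show "c {x, y} = c {y, x}" for x y
      by (simp add: insert_commute)
    show False
      if adj: "G_adj p q" "G_adj p r" "G_adj p s" "G_adj q r" "G_adj q s" and "r \<noteq> s"
        and col: "c {p, q} = k" "c {p, r} = k" "c {p, s} = k" "c {q, r} = k" "c {q, s} = k"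
      for p q r s k
    proof -
      have V: "{p, q, r, s} \<subseteq> {..<51}" "distinct [p, q, r, s]"
        using adj G_adj_less G_adj_irrefl \<open>r \<noteq> s\<close> by auto
      have "has_copy J4_V J4_E {..<51} {e \<in> G_E. c e = k}"
        by (rule has_copy_J4I[OF V]) (simp_all add: G_E_iff adj col)
      then show False
        using nocopy by (cases k) simp_all
    qed
  qed
  define f where "f v = c {50, v}" for v
  define S where "S i k = {v. v < 50 \<and> blob v = i \<and> f v = k}" for i k
  \<comment> \<open>The third vertex of a listed triangle is distinguished, so three blobs heavy in
    the same colour supply parts of sizes 2, 2 and 3.\<close>
  define heavy where "heavy i k \<longleftrightarrow>
      2 \<le> card (S i k) \<and> (i \<in> {10, 11, 12, 13} \<longrightarrow> 3 \<le> card (S i k))" for i k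
  have S_eq: "S i k = {v \<in> {v. v < 50 \<and> blob v = i}. f v = k}" for i k
    unfolding S_def by auto
  have "\<exists>k. heavy i k" if "i < 14" for i
  proof (cases "i \<in> {10, 11, 12, 13}")
    case True
    from card_blob_ge_5[OF this] have "\<exists>k. 3 \<le> card (S i k)"
      unfolding S_eq by (intro pigeonhole_two_colours) simp
    then show ?thesis
      unfolding heavy_def by (meson numeral_le_iff order_trans semiring_norm)
  next
    case False
    from card_blob_ge_3[OF that] have "\<exists>k. 2 \<le> card (S i k)"
      unfolding S_eq by (intro pigeonhole_two_colours) simp
    with False show ?thesis
      unfolding heavy_def by blast
  qed
  then obtain h where h: "heavy i (h i)" if "i < 14" for i
    by metis
  obtain i j l where ijl: "(i, j, l) \<in> set core_triangles" "h j = h i" "h l = h i"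
    using core_monochromatic_triangle[of h] by auto
  note t = core_triangles_adj[OF ijl(1)]
  have "l < 14"
    using t(6) by auto
  have "2 \<le> card (S i (h i))" "2 \<le> card (S j (h i))" "3 \<le> card (S l (h i))"
    using h[OF t(4)] h[OF t(5)] h[OF \<open>l < 14\<close>] t(6) ijl(2,3) unfolding heavy_def by auto
  then obtain X Y Z where "X \<subseteq> S i (h i)" "card X = 2" "Y \<subseteq> S j (h i)" "card Y = 2"
    "Z \<subseteq> S l (h i)" "card Z = 3"
    using obtain_subset_with_card_n by metis
  then obtain x x' y y' z z' z'' where x: "{x, x'} \<subseteq> S i (h i)" "x \<noteq> x'"
    and y: "{y, y'} \<subseteq> S j (h i)" "y \<noteq> y'"
    and z: "{z, z', z''} \<subseteq> S l (h i)" "distinct [z, z', z'']"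
    unfolding card_2_iff card_3_iff by auto
  have adj: "adjacent_all G_adj X Y" if "X \<subseteq> S a k" "Y \<subseteq> S b k" "core_adj a b" for X Y a b k
    using that core_adj_sym unfolding adjacent_all_def G_adj_def S_def by blast
  let ?U = "{x, x', y, y', z, z', z''}"
  have U: "?U \<subseteq> {v. v < 50 \<and> f v = h i}"
    using x(1) y(1) z(1) unfolding S_def by auto
  show False
  proof (rule no_monochromatic_K223)
    show "adjacent_all G_adj {50} ?U"
      using U unfolding adjacent_all_def G_adj_def by auto
    show "adjacent_all G_adj {x, x'} {y, y'}" "adjacent_all G_adj {x, x'} {z, z', z''}"
      "adjacent_all G_adj {y, y'} {z, z', z''}"
      using adj x(1) y(1) z(1) t(1-3) by blast+
    show "x \<noteq> x'" "y \<noteq> y'" "distinct [z, z', z'']"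
      by (fact x y z)+
    show "\<forall>v\<in>?U. c {50, v} = h i"
      using U unfolding f_def by auto
  qed
qed

theorem theorem10:
  shows "\<exists>(V :: nat set) E. simple_graph V E \<and> card V = 51 \<and> clique_free 5 V E \<and>
           edge_arrows V E J4_V J4_E J4_V J4_E"
  using simple_graph_G clique_free_G J4_arrows_G card_lessThan by blast

end
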